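(* The sequence $(\xi_{n,n})_{n\geq 2}$ is convergent to $0$.
   Context: Let $X$ be a finite alphabet with $n\ge 2$ letters. A code with length distribution $L=(a_1,\ldots,a_m)$, where the $a_i$ are positive integers, is a finite sequence $(v_1,\ldots,v_m)$ of words $v_i\in X^*$ with $|v_i|=a_i$ for all $i$. A code is a prefix code if it is an injective sequence of non-empty words such that no $v_i$ is a prefix (initial segment) of another code word $v_j$, $j\ne i$. A code $(v_1,\ldots,v_m)$ is uniquely decodable if $v_{i_1}v_{i_2}\cdots v_{i_t}=v_{j_1}v_{j_2}\cdots v_{j_{t'}}$ with $t,t'\geq 1$ and all indices in $\{1,\ldots,m\}$ implies $t=t'$ and $i_s=j_s$ for every $1\leq s\leq t$. $UD_n(L)$ denotes the set of uniquely decodable codes over an $n$-letter alphabet with length distribution $L$, and $PR_n(L)\subseteq UD_n(L)$ the subset of prefix codes. $\mathcal{L}_{n,m}$ is the set of sequences $L$ of positive integers of length $|L|=m$ with $UD_n(L)\neq\emptyset$ (equivalently, by Kraft-McMillan, $PR_n(L)\ne\emptyset$, equivalently $\sum_{i=1}^m n^{-a_i}\leq 1$). For $n\geq 2$, $m\geq 1$ define $$\xi_{n,m}:=\inf_{L\in\mathcal{L}_{n,m}}\frac{|PR_n(L)|}{|UD_n(L)|};$$ $\xi_{n,n}$ is the case $m=n$. *)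

theory Defs
  imports "HOL-Analysis.Analysis" "HOL-Library.Sublist"
begin

definition codes :: "'a set \<Rightarrow> nat list \<Rightarrow> 'a list list set" where
  "codes X L = {vs. length vs = length L \<and>
     (\<forall>i<length L. vs ! i \<in> lists X \<and> length (vs ! i) = L ! i)}"

definition prefix_code :: "'a list list \<Rightarrow> bool" where
  "prefix_code vs \<longleftrightarrow> distinct vs \<and> [] \<notin> set vs \<and>
     (\<forall>i<length vs. \<forall>j<length vs. i \<noteq> j \<longrightarrow> \<not> prefix (vs ! i) (vs ! j))"

definition uniquely_decodable :: "'a list list \<Rightarrow> bool" where
  "uniquely_decodable vs \<longleftrightarrow>
     (\<forall>is js. is \<noteq> [] \<longrightarrow> js \<noteq> [] \<longrightarrow> set is \<subseteq> {..<length vs} \<longrightarrow> set js \<subseteq> {..<length vs} \<longrightarrow>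
        concat (map (\<lambda>i. vs ! i) is) = concat (map (\<lambda>j. vs ! j) js) \<longrightarrow> is = js)"

text \<open>The \<open>n\<close>-letter alphabet is \<open>{..<n}\<close>; the cardinalities below depend on the alphabet
  only through its size.\<close>

definition UD :: "nat \<Rightarrow> nat list \<Rightarrow> nat list list set" where
  "UD n L = {vs \<in> codes {..<n} L. uniquely_decodable vs}"

definition PR :: "nat \<Rightarrow> nat list \<Rightarrow> nat list list set" where
  "PR n L = {vs \<in> codes {..<n} L. prefix_code vs}"

definition UD_distributions :: "nat \<Rightarrow> nat \<Rightarrow> nat list set" where
  "UD_distributions n m = {L. length L = m \<and> (\<forall>a\<in>set L. 0 < a) \<and> UD n L \<noteq> {}}"

definition xi :: "nat \<Rightarrow> nat \<Rightarrow> real" where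
  "xi n m = (INF L\<in>UD_distributions n m. real (card (PR n L)) / real (card (UD n L)))"

lemma finite_codes:
  assumes "finite X"
  shows "finite (codes X L)"
proof (rule finite_subset)
  let ?W = "{w. set w \<subseteq> X \<and> length w \<le> sum_list L}"
  show "codes X L \<subseteq> {vs. set vs \<subseteq> ?W \<and> length vs = length L}"
  proof
    fix vs
    assume vs: "vs \<in> codes X L"
    have "w \<in> ?W" if w: "w \<in> set vs" for w
    proof -
      obtain i where "i < length vs" "w = vs ! i"
        using w by (auto simp: in_set_conv_nth)
      with vs have "i < length L" "w \<in> lists X" "length w = L ! i"
        by (auto simp: codes_def)
      then show ?thesis
        by (auto intro!: member_le_sum_list)
    qed
    with vs show "vs \<in> {vs. set vs \<subseteq> ?W \<and> length vs = length L}"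
      by (auto simp: codes_def)
  qed
  show "finite {vs. set vs \<subseteq> ?W \<and> length vs = length L}"
    by (intro finite_lists_length_eq finite_lists_length_le assms)
qed

lemma finite_UD: "finite (UD n L)"
  by (simp add: UD_def finite_codes)

lemma prefix_code_imp_uniquely_decodable:
  assumes "prefix_code vs"
  shows "uniquely_decodable vs"
proof -
  have ne: "vs ! i \<noteq> []" if "i < length vs" for i
    using assms nth_mem[OF that] unfolding prefix_code_def by metis
  have inc: "i = j"
    if "i < length vs" "j < length vs" "prefix (vs ! i) (vs ! j) \<or> prefix (vs ! j) (vs ! i)" for i j
    using assms that unfolding prefix_code_def by metis
  have "is = js"
    if "set is \<subseteq> {..<length vs}" "set js \<subseteq> {..<length vs}"
      and "concat (map (\<lambda>i. vs ! i) is) = concat (map (\<lambda>j. vs ! j) js)" for "is" js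
    using that
  proof (induction "is" arbitrary: js)
    case Nil
    then show ?case
      using ne by (cases js) auto
  next
    case (Cons i "is")
    show ?case
    proof (cases js)
      case Nil
      with Cons.prems ne show ?thesis
        by auto
    next
      case js: (Cons j js')
      have eq: "vs ! i @ concat (map (\<lambda>i. vs ! i) is) = vs ! j @ concat (map (\<lambda>j. vs ! j) js')"
        using Cons.prems js by simp
      then have "prefix (vs ! i) (vs ! j) \<or> prefix (vs ! j) (vs ! i)"
        by (metis prefixI prefix_same_cases)
      then have "i = j"
        using inc Cons.prems js by simp
      with eq Cons.IH[of js'] Cons.prems js show ?thesis
        by simp
    qed
  qed
  then show ?thesis
    unfolding uniquely_decodable_def by blast
qed

lemma PR_subset_UD: "PR n L \<subseteq> UD n L"
  by (auto simp: PR_def UD_def prefix_code_imp_uniquely_decodable)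

end

theory Submission
  imports Defs
begin

text \<open>Take the length distribution \<open>(1, \<dots>, 1, a)\<close> with \<open>n - 1\<close> ones. The one-letter words use all
  letters but one, say \<open>b\<close>, and the code is uniquely decodable as soon as the remaining word \<open>w\<close>
  contains \<open>b\<close>, because the first \<open>b\<close> of a message must come from the first \<open>b\<close> of an occurrence
  of \<open>w\<close>. It is a prefix code only if \<open>w\<close> starts with \<open>b\<close>. Hence the ratio is at most
  \<open>n ^ (a - 1) / (n ^ a - (n - 1) ^ a)\<close>, which tends to \<open>1 / n\<close> as \<open>a\<close> grows.\<close>

section \<open>Codes formed by single letters and one further word\<close>

definition letters_and_word :: "'a list \<Rightarrow> 'a list \<Rightarrow> 'a list list" where
  "letters_and_word A w = map (\<lambda>x. [x]) A @ [w]"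

lemma length_letters_and_word [simp]: "length (letters_and_word A w) = Suc (length A)"
  by (simp add: letters_and_word_def)

lemma nth_letters_and_word:
  "i \<le> length A \<Longrightarrow> letters_and_word A w ! i = (if i < length A then [A ! i] else w)"
  by (auto simp: letters_and_word_def nth_append)

lemma letters_and_word_inject:
  "letters_and_word A w = letters_and_word B v \<longleftrightarrow> A = B \<and> w = v"
proof -
  have "inj (\<lambda>x::'a. [x])"
    by (simp add: inj_def)
  then show ?thesis
    by (simp add: letters_and_word_def inj_map_eq_map)
qed

section \<open>Unique decodability through initial runs of letters of \<open>A\<close>\<close>

text \<open>A letter outside \<open>A\<close> can only come from a copy of \<open>w\<close>, and
  whatever precedes the first such copy consists of letters of \<open>A\<close>. The initial run of
  letters of \<open>A\<close> in the message therefore includes the one in \<open>w\<close>.\<close>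

lemma length_takeWhile_concat_ge:
  assumes w: "\<not> set w \<subseteq> set A"
    and "set is \<subseteq> {..length A}"
    and "\<not> set (concat (map ((!) (letters_and_word A w)) is)) \<subseteq> set A"
  shows "length (takeWhile (\<lambda>x. x \<in> set A) w)
    \<le> length (takeWhile (\<lambda>x. x \<in> set A) (concat (map ((!) (letters_and_word A w)) is)))"
  using assms(2,3)
proof (induction "is")
  case Nil
  then show ?case by simp
next
  case (Cons i "is")
  show ?case
  proof (cases "i < length A")
    case True
    with Cons show ?thesis
      by (simp add: nth_letters_and_word)
  next
    case False
    with Cons.prems have "letters_and_word A w ! i = w"
      by (simp add: nth_letters_and_word)
    \<comment> \<open>Since \<open>w\<close> leaves \<open>A\<close>, the run already stops inside
      this first copy of \<open>w\<close>, whatever follows.\<close>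
    moreover obtain x where "x \<in> set w" "x \<notin> set A"
      using w by blast
    ultimately show ?thesis
      by (simp add: takeWhile_append1)
  qed
qed

text \<open>The two sides have initial runs of different lengths: on the right it is exactly the run
  of \<open>w\<close>, while on the left the leading \<open>x\<close> makes it at least one
  longer.\<close>

lemma letter_start_neq_word_start:
  assumes w: "\<not> set w \<subseteq> set A" and x: "x \<in> set A" and "is": "set is \<subseteq> {..length A}"
  shows "x # concat (map ((!) (letters_and_word A w)) is) \<noteq> w @ v"
proof
  let ?c = "concat (map ((!) (letters_and_word A w)) is)"
  assume eq: "x # ?c = w @ v"
  obtain y where y: "y \<in> set w" "y \<notin> set A"
    using w by blast
  \<comment> \<open>As \<open>x\<close> lies in \<open>A\<close> and \<open>y\<close> does not,
    \<open>y\<close> must occur in \<open>?c\<close>, which makes the run bound applicable.\<close>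
  have "y \<in> set (x # ?c)"
    using y eq by simp
  then have "\<not> set ?c \<subseteq> set A"
    using x y by auto
  from length_takeWhile_concat_ge[OF w "is" this]
  have "length (takeWhile (\<lambda>x. x \<in> set A) w) < length (takeWhile (\<lambda>x. x \<in> set A) (x # ?c))"
    using x by simp
  moreover have "takeWhile (\<lambda>x. x \<in> set A) (w @ v) = takeWhile (\<lambda>x. x \<in> set A) w"
    using y by (simp add: takeWhile_append1)
  ultimately show False
    by (simp add: eq)
qed

text \<open>Two decodings of one message must agree in their first index: distinctness of
  \<open>A\<close> separates the letters, and a letter cannot compete with \<open>w\<close> by the
  run argument. Cancelling the first code word leaves an induction.\<close>

lemma uniquely_decodable_letters_and_word:
  assumes A: "distinct A" and w: "\<not> set w \<subseteq> set A"
  shows "uniquely_decodable (letters_and_word A w)"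
proof -
  let ?v = "(!) (letters_and_word A w)"
  have ne: "?v i \<noteq> []" if "i \<le> length A" for i
    using that w by (auto simp: nth_letters_and_word)
  have "is = js"
    if "set is \<subseteq> {..length A}" "set js \<subseteq> {..length A}"
      and "concat (map ?v is) = concat (map ?v js)" for "is" js
    using that
  proof (induction "is" arbitrary: js)
    case Nil
    then show ?case
      using ne by (cases js) auto
  next
    case (Cons i "is")
    show ?case
    proof (cases js)
      case Nil
      with Cons.prems ne show ?thesis
        by auto
    next
      case js: (Cons j js')
      have le: "i \<le> length A" "j \<le> length A" "set is \<subseteq> {..length A}" "set js' \<subseteq> {..length A}"
        using Cons.prems js by auto
      have eq: "?v i @ concat (map ?v is) = ?v j @ concat (map ?v js')"
        using Cons.prems js by simp
      have "i = j"
      proof (cases "i < length A"; cases "j < length A")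
        assume "i < length A" "j < length A"
        with eq A show ?thesis
          by (simp add: nth_letters_and_word nth_eq_iff_index_eq)
      next
        assume i: "i < length A" and j: "\<not> j < length A"
        from eq i j le have "A ! i # concat (map ?v is) = w @ concat (map ?v js')"
          by (simp add: nth_letters_and_word)
        with letter_start_neq_word_start[OF w nth_mem[OF i] le(3)] show ?thesis
          by blast
      next
        assume i: "\<not> i < length A" and j: "j < length A"
        from eq i j le have "A ! j # concat (map ?v js') = w @ concat (map ?v is)"
          by (simp add: nth_letters_and_word)
        with letter_start_neq_word_start[OF w nth_mem[OF j] le(4)] show ?thesis
          by blast
      qed (use le in simp)
      with eq Cons.IH[of js'] le js show ?thesis
        by simp
    qed
  qed
  then show ?thesis
    unfolding uniquely_decodable_def by (simp add: lessThan_Suc_atMost)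
qed

section \<open>Counting prefix codes and uniquely decodable codes\<close>

text \<open>Ordered choices, because codes are sequences. For positive \<open>n\<close> each choice
  omits exactly one letter of the alphabet.\<close>

definition letter_choices :: "nat \<Rightarrow> nat list set" where
  "letter_choices n = {A. distinct A \<and> set A \<subseteq> {..<n} \<and> length A = n - 1}"

lemma finite_letter_choices: "finite (letter_choices n)"
  by (rule finite_subset[OF _ finite_lists_length_eq[of "{..<n}" "n - 1"]])
    (auto simp: letter_choices_def)

lemma letter_choices_nonempty: "letter_choices n \<noteq> {}"
proof -
  have "[0..<n - 1] \<in> letter_choices n"
    by (auto simp: letter_choices_def)
  then show ?thesis
    by blast
qed

lemma letters_and_word_in_codes:
  assumes "n \<ge> 1" "A \<in> letter_choices n" "set w \<subseteq> {..<n}" "length w = a"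
  shows "letters_and_word A w \<in> codes {..<n} (replicate (n - 1) 1 @ [a])"
proof -
  have "A ! i < n" if "i < n - 1" for i
  proof -
    have "A ! i \<in> set A" "set A \<subseteq> {..<n}"
      using assms(2) that by (simp_all add: letter_choices_def)
    then show ?thesis
      by blast
  qed
  then show ?thesis
    using assms by (auto simp: codes_def letter_choices_def nth_letters_and_word nth_append)
qed

text \<open>Prefix-freeness makes the one-letter words distinct, and it forbids the last word to
  begin with any of them.\<close>

lemma PR_letters_and_word:
  assumes n: "n \<ge> 1" and a: "a \<ge> 1" and vs: "vs \<in> PR n (replicate (n - 1) 1 @ [a])"
  obtains A x w where "A \<in> letter_choices n" "x \<in> {..<n} - set A" "set w \<subseteq> {..<n}"
    "length w = a - 1" "vs = letters_and_word A (x # w)"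
proof -
  have len: "length vs = n" and pc: "prefix_code vs"
    and words: "\<And>i. i < n \<Longrightarrow> set (vs ! i) \<subseteq> {..<n}"
      "\<And>i. i < n - 1 \<Longrightarrow> length (vs ! i) = 1" "length (vs ! (n - 1)) = a"
    using vs n by (auto simp: PR_def codes_def nth_append in_lists_conv_set)
  define A where "A = map (\<lambda>i. hd (vs ! i)) [0..<n - 1]"
  have lenA [simp]: "length A = n - 1"
    by (simp add: A_def)
  have vsA: "vs ! i = [A ! i]" if "i < n - 1" for i
    using words(2)[OF that] that by (cases "vs ! i") (auto simp: A_def)
  obtain x w where xw: "vs ! (n - 1) = x # w"
    using words(3) a by (cases "vs ! (n - 1)") auto
  have vs_eq: "vs = letters_and_word A (x # w)"
  proof (rule nth_equalityI)
    fix i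
    assume "i < length vs"
    then have "i < n - 1 \<or> i = n - 1"
      using len by linarith
    then show "vs ! i = letters_and_word A (x # w) ! i"
      using vsA xw by (auto simp: nth_letters_and_word)
  qed (use len n in simp)
  have "distinct A"
    unfolding distinct_conv_nth
  proof (intro allI impI)
    fix i j
    assume ij: "i < length A" "j < length A" "i \<noteq> j"
    then have "\<not> prefix (vs ! i) (vs ! j)"
      using pc len by (simp add: prefix_code_def)
    then show "A ! i \<noteq> A ! j"
      using ij vsA by auto
  qed
  moreover have "set A \<subseteq> {..<n}"
  proof
    fix y
    assume "y \<in> set A"
    then obtain i where i: "i < n - 1" "y = A ! i"
      by (auto simp: in_set_conv_nth)
    then show "y \<in> {..<n}"
      using words(1)[of i] vsA[of i] by simp
  qed
  moreover have "x \<notin> set A"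
  proof
    assume "x \<in> set A"
    then obtain i where i: "i < n - 1" "x = A ! i"
      by (auto simp: in_set_conv_nth)
    then have "prefix (vs ! i) (vs ! (n - 1))"
      using vsA xw by simp
    then show False
      using pc len i n by (simp add: prefix_code_def)
  qed
  moreover have "x < n" "set w \<subseteq> {..<n}" "length w = a - 1"
    using words(1)[of "n - 1"] words(3) xw n by auto
  ultimately show ?thesis
    using that[of A x w] vs_eq by (simp add: letter_choices_def)
qed

text \<open>The first letter of the long word is forced to be the single omitted one, so only its
  other \<open>a - 1\<close> letters are free.\<close>

lemma card_PR_le:
  assumes n: "n \<ge> 1" and a: "a \<ge> 1"
  shows "card (PR n (replicate (n - 1) 1 @ [a])) \<le> card (letter_choices n) * n ^ (a - 1)"
proof -
  let ?W = "{w. set w \<subseteq> {..<n} \<and> length w = a - 1}"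
  let ?S = "SIGMA A:letter_choices n. ({..<n} - set A) \<times> ?W"
  have fin: "finite ?W" and cW: "card ?W = n ^ (a - 1)"
    using finite_lists_length_eq[of "{..<n}"] card_lists_length_eq[of "{..<n}"] by auto
  have card_missing: "card ({..<n} - set A) = 1" if "A \<in> letter_choices n" for A
    using that n by (auto simp: letter_choices_def card_Diff_subset distinct_card)
  have "PR n (replicate (n - 1) 1 @ [a]) \<subseteq> (\<lambda>(A, x, w). letters_and_word A (x # w)) ` ?S"
  proof
    fix vs
    assume "vs \<in> PR n (replicate (n - 1) 1 @ [a])"
    then obtain A x w where "A \<in> letter_choices n" "x \<in> {..<n} - set A" "set w \<subseteq> {..<n}"
      "length w = a - 1" and vs: "vs = letters_and_word A (x # w)"
      by (rule PR_letters_and_word[OF n a])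
    then have "(A, x, w) \<in> ?S"
      by simp
    with vs show "vs \<in> (\<lambda>(A, x, w). letters_and_word A (x # w)) ` ?S"
      by (intro image_eqI[where x = "(A, x, w)"]) simp_all
  qed
  moreover have finS: "finite ?S"
    using fin finite_letter_choices by auto
  ultimately have "card (PR n (replicate (n - 1) 1 @ [a])) \<le> card ?S"
    by (rule surj_card_le[rotated])
  also have "card ?S = (\<Sum>A\<in>letter_choices n. card (({..<n} - set A) \<times> ?W))"
    by (rule card_SigmaI) (use fin finite_letter_choices in auto)
  also have "\<dots> = card (letter_choices n) * n ^ (a - 1)"
    by (simp add: card_cartesian_product card_missing cW del: One_nat_def)
  finally show ?thesis .
qed

text \<open>For each choice of letters, every word of length \<open>a\<close> containing the omitted
  letter gives a uniquely decodable code; the subtracted term counts the words that avoid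
  it.\<close>

lemma card_UD_ge:
  assumes n: "n \<ge> 1"
  shows "card (letter_choices n) * (n ^ a - (n - 1) ^ a) \<le> card (UD n (replicate (n - 1) 1 @ [a]))"
proof -
  let ?W = "\<lambda>B. {w. set w \<subseteq> B \<and> length w = a}"
  let ?S = "SIGMA A:letter_choices n. ?W {..<n} - ?W (set A)"
  let ?f = "\<lambda>(A, w). letters_and_word A w"
  have fin: "finite (?W {..<n})"
    by (simp add: finite_lists_length_eq)
  have card_words: "card (?W {..<n} - ?W (set A)) = n ^ a - (n - 1) ^ a"
    if "A \<in> letter_choices n" for A
  proof -
    have "?W (set A) \<subseteq> ?W {..<n}"
      using that by (auto simp: letter_choices_def)
    then have "card (?W {..<n} - ?W (set A)) = card (?W {..<n}) - card (?W (set A))"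
      by (rule card_Diff_subset[rotated]) (simp add: finite_lists_length_eq)
    also have "\<dots> = n ^ a - (n - 1) ^ a"
      using that by (simp add: card_lists_length_eq letter_choices_def distinct_card)
    finally show ?thesis .
  qed
  have "card (letter_choices n) * (n ^ a - (n - 1) ^ a)
      = (\<Sum>A\<in>letter_choices n. card (?W {..<n} - ?W (set A)))"
    by (simp add: card_words)
  also have "\<dots> = card ?S"
    by (rule card_SigmaI[symmetric]) (use fin finite_letter_choices in auto)
  also have "\<dots> = card (?f ` ?S)"
    by (rule card_image[symmetric]) (auto simp: inj_on_def letters_and_word_inject)
  also have "\<dots> \<le> card (UD n (replicate (n - 1) 1 @ [a]))"
  proof (rule card_mono[OF finite_UD], rule subsetI)
    fix vs
    assume "vs \<in> ?f ` ?S"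
    then obtain A w where "A \<in> letter_choices n" "set w \<subseteq> {..<n}" "length w = a"
      "\<not> set w \<subseteq> set A" "vs = letters_and_word A w"
      by auto
    then show "vs \<in> UD n (replicate (n - 1) 1 @ [a])"
      using letters_and_word_in_codes[OF n] uniquely_decodable_letters_and_word[of A w]
      by (simp add: UD_def letter_choices_def)
  qed
  finally show ?thesis .
qed

section \<open>Bounds on \<open>xi\<close> and the limit\<close>

lemma xi_le:
  assumes "L \<in> UD_distributions n m"
  shows "xi n m \<le> real (card (PR n L)) / real (card (UD n L))"
  unfolding xi_def by (rule cINF_lower[OF bdd_belowI2[where m = 0] assms]) simp

lemma xi_nonneg:
  assumes "UD_distributions n m \<noteq> {}"
  shows "xi n m \<ge> 0"
  unfolding xi_def by (rule cINF_greatest[OF assms]) simp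

text \<open>A single sufficiently large \<open>a\<close> for each \<open>n\<close> replaces the
  limit in \<open>a\<close>, at the price of the factor 2.\<close>

lemma xi_diagonal_bounds:
  assumes n: "n \<ge> 1"
  shows "0 \<le> xi n n" "xi n n \<le> 2 / real n"
proof -
  \<comment> \<open>With this \<open>a\<close>, fewer than half of all words of length
    \<open>a\<close> avoid a given letter.\<close>
  obtain a where a: "(real (n - 1) / real n) ^ a < 1 / 2"
    using real_arch_pow_inv[of "1 / 2" "real (n - 1) / real n"] n by auto
  define L where "L = replicate (n - 1) 1 @ [a]"
  define s where "s = real (card (letter_choices n))"
  define u where "u = real (card (UD n L))"
  \<comment> \<open>For \<open>a = 0\<close> the chosen inequality would read 1 < 1/2.\<close>
  have a1: "a \<ge> 1"
    using a by (cases a) auto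
  have half: "2 * real (n - 1) ^ a < real n ^ a"
    using a n by (simp add: power_divide field_simps)
  have s: "s > 0"
    using finite_letter_choices letter_choices_nonempty by (simp add: s_def card_gt_0_iff)
  have PR: "real (card (PR n L)) \<le> s * real n ^ (a - 1)"
    using card_PR_le[OF n a1] unfolding L_def s_def
    by (metis of_nat_le_iff of_nat_mult of_nat_power)
  have "(n - 1) ^ a \<le> n ^ a"
    by (simp add: power_mono)
  then have "s * (real n ^ a - real (n - 1) ^ a) \<le> u"
    using card_UD_ge[OF n, of a] unfolding L_def s_def u_def
    by (metis of_nat_diff of_nat_le_iff of_nat_mult of_nat_power)
  moreover have "s * (real n ^ a / 2) \<le> s * (real n ^ a - real (n - 1) ^ a)"
    using half s by (intro mult_left_mono) auto
  ultimately have UD: "s * (real n ^ a / 2) \<le> u"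
    by linarith
  have pos: "s * (real n ^ a / 2) > 0"
    using s n by simp
  \<comment> \<open>The counting bound also shows that \<open>L\<close> is admissible in the
    infimum.\<close>
  have "UD n L \<noteq> {}"
    using UD pos by (auto simp: u_def)
  then have L: "L \<in> UD_distributions n n"
    using n a1 by (auto simp: UD_distributions_def L_def)
  then show "0 \<le> xi n n"
    by (intro xi_nonneg) blast
  have "xi n n \<le> real (card (PR n L)) / u"
    using xi_le[OF L] by (simp add: u_def)
  also have "\<dots> \<le> (s * real n ^ (a - 1)) / (s * (real n ^ a / 2))"
    by (rule frac_le) (use PR UD pos s in auto)
  \<comment> \<open>The number \<open>s\<close> of letter choices cancels; \<open>a1\<close> ensures
    that \<open>a - 1\<close> is a genuine predecessor.\<close>
  also have "\<dots> = 2 / real n"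
    using s n a1 by (cases a) auto
  finally show "xi n n \<le> 2 / real n" .
qed

theorem corollary2:
  shows "(\<lambda>n. xi n n) \<longlonglongrightarrow> 0"
proof (rule tendsto_sandwich[where f = "\<lambda>_. 0" and h = "\<lambda>n. 2 / real n"])
  \<comment> \<open>Both bounds hold from \<open>n = 1\<close> on, hence eventually.\<close>
  show "\<forall>\<^sub>F n in sequentially. 0 \<le> xi n n"
    using xi_diagonal_bounds(1) by (auto simp: eventually_sequentially)
  show "\<forall>\<^sub>F n in sequentially. xi n n \<le> 2 / real n"
    using xi_diagonal_bounds(2) by (auto simp: eventually_sequentially)
  show "(\<lambda>n. 2 / real n) \<longlonglongrightarrow> 0"
    by (rule lim_const_over_n)
qed simp

end
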